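(* Let $Y\subset\mathbb{R}^p$ be nonempty and compact, let $X\subset\mathbb{R}^d$, let $S:X\rightrightarrows Y$ be a set-valued map with nonempty values and closed graph, let $\beta:X\to\mathscr{P}(Y)$ be a belief over $S$, and let $\theta:X\times Y\to\mathbb{R}$. Assume that: (i) $\theta$ is lower semicontinuous; (ii) $X$ is nonempty and compact; (iii) $\beta:X\to\mathscr{P}(Y)$ is weak continuous. Then the function $x\mapsto \mathbb{E}_{\beta_x}(\theta(x,\cdot))=\int_Y\theta(x,y)\,d\beta_x(y)$ is lower semicontinuous on $X$, and so the single-leader bilevel game under the Bayesian approach, $\min_{x\in X}\mathbb{E}_{\beta_x}(\theta(x,\cdot))$, admits at least one solution.
   Context: $\mathscr{P}(Y)$ is the set of Borel probability measures on $Y$ with the topology of weak convergence: $\nu_n\to\nu$ weakly if $\int_Y f\,d\nu_n\to\int_Y f\,d\nu$ for all continuous $f:Y\to\mathbb{R}$ with bounded support. A map $\beta:X\to\mathscr{P}(Y)$, $x\mapsto\beta_x$, is weak continuous if $x_n\to x$ in $X$ implies $\beta_{x_n}\to\beta_x$ weakly. A belief over $S$ (a set-valued map with nonempty Borel measurable values) is a map $\beta:X\to\mathscr{P}(Y)$ with $\beta_x(S(x))=1$ for all $x\in X$. *)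

theory Defs
  imports "HOL-Probability.Probability"
begin

text \<open>
  Polymorphic in the codomain, so that it applies both to real-valued functions and to the
  extended real-valued expected cost.
\<close>
definition lower_semicontinuous_on ::
  "'a::topological_space set \<Rightarrow> ('a \<Rightarrow> 'b::linorder) \<Rightarrow> bool" where
  "lower_semicontinuous_on A f \<longleftrightarrow>
     (\<forall>x\<in>A. \<forall>c. c < f x \<longrightarrow> (\<forall>\<^sub>F z in at x within A. c < f z))"

definition borel_probabilities :: "'a::topological_space set \<Rightarrow> 'a measure set" where
  "borel_probabilities Y = {M. sets M = sets (restrict_space borel Y) \<and> prob_space M}"

text \<open>
  The test functions are the continuous functions on \<open>Y\<close> with bounded support; whether or not
  the closure of the set where \<open>f\<close> does not vanish is taken is irrelevant for boundedness.
\<close>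
definition weakly_convergent_to ::
  "'a::metric_space set \<Rightarrow> (nat \<Rightarrow> 'a measure) \<Rightarrow> 'a measure \<Rightarrow> bool" where
  "weakly_convergent_to Y \<nu>s \<nu> \<longleftrightarrow>
     (\<forall>f :: 'a \<Rightarrow> real. continuous_on Y f \<and> bounded {y\<in>Y. f y \<noteq> 0} \<longrightarrow>
        (\<lambda>n. LINT y|\<nu>s n. f y) \<longlonglongrightarrow> (LINT y|\<nu>. f y))"

definition weak_continuous_on ::
  "'x::topological_space set \<Rightarrow> 'y::metric_space set \<Rightarrow> ('x \<Rightarrow> 'y measure) \<Rightarrow> bool" where
  "weak_continuous_on X Y \<beta> \<longleftrightarrow>
     (\<forall>xs. \<forall>x\<in>X. (\<forall>n. xs n \<in> X) \<and> xs \<longlonglongrightarrow> x \<longrightarrow>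
        weakly_convergent_to Y (\<lambda>n. \<beta> (xs n)) (\<beta> x))"

definition belief_over ::
  "'x set \<Rightarrow> 'y::topological_space set \<Rightarrow> ('x \<Rightarrow> 'y set) \<Rightarrow> ('x \<Rightarrow> 'y measure) \<Rightarrow> bool" where
  "belief_over X Y S \<beta> \<longleftrightarrow>
     (\<forall>x\<in>X. S x \<subseteq> Y \<and> S x \<noteq> {} \<and> S x \<in> sets borel) \<and>
     (\<forall>x\<in>X. \<beta> x \<in> borel_probabilities Y \<and> measure (\<beta> x) (S x) = 1)"

text \<open>
  The integral with values in \<open>[-\<infinity>, \<infinity>]\<close>, as the integral of the positive part minus the
  integral of the negative part (\<open>ennreal\<close> maps negative reals to 0). The Bochner integral is not
  suitable here, since it is 0 rather than \<open>\<infinity>\<close> for functions whose integral diverges. The value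
  is meaningful unless both parts have infinite integral; a lower semicontinuous function on a
  compact set is bounded below, so its negative part is integrable.
\<close>
definition extended_integral :: "'a measure \<Rightarrow> ('a \<Rightarrow> real) \<Rightarrow> ereal" where
  "extended_integral M f =
     enn2ereal (\<integral>\<^sup>+ y. ennreal (f y) \<partial>M) - enn2ereal (\<integral>\<^sup>+ y. ennreal (- f y) \<partial>M)"

definition expected_cost ::
  "('x \<Rightarrow> 'y measure) \<Rightarrow> ('x \<times> 'y \<Rightarrow> real) \<Rightarrow> 'x \<Rightarrow> ereal" where
  "expected_cost \<beta> \<theta> x = extended_integral (\<beta> x) (\<lambda>y. \<theta> (x, y))"

end

theory Submission
  imports Defs
begin

text \<open>
  A lower semicontinuous \<open>\<theta>\<close> on the compact set \<open>X \<times> Y\<close> is bounded below, so it is the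
  increasing pointwise limit of its Lipschitz envelopes
  \<open>\<theta>\<^sub>k p = inf\<^sub>q (\<theta> q + k d(p, q))\<close>. Each \<open>x \<mapsto> \<integral> \<theta>\<^sub>k (x, y) d\<beta>\<^sub>x(y)\<close> is continuous,
  by uniform continuity in the first argument of \<open>\<theta>\<^sub>k\<close> and weak continuity of \<open>\<beta>\<close>. By monotone
  convergence the expected cost is the supremum of these functions, hence lower semicontinuous,
  and so attains its minimum on the compact set \<open>X\<close>.
\<close>

section \<open>Minimisers of lower semicontinuous functions on compact sets\<close>

text \<open>Without a minimiser, the strict superlevel sets \<open>?U y\<close> form a relatively
  open cover of \<open>K\<close>, and a finite subcover is contradictory. The codomain is an
  arbitrary linear order because the result serves twice: for the real-valued \<theta> and for the
  \<open>ereal\<close>-valued expected cost.\<close>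

lemma lower_semicontinuous_on_attains_min:
  fixes f :: "'a::topological_space \<Rightarrow> 'b::linorder"
  assumes lsc: "lower_semicontinuous_on K f" and "compact K" "K \<noteq> {}"
  obtains x where "x \<in> K" "\<And>y. y \<in> K \<Longrightarrow> f x \<le> f y"
proof (rule ccontr)
  note min = that
  assume "\<not> thesis"
  have below: "\<exists>y\<in>K. f y < f x" if "x \<in> K" for x
  proof (rule ccontr)
    assume "\<not> (\<exists>y\<in>K. f y < f x)"
    then have "f x \<le> f y" if "y \<in> K" for y
      using that by (meson not_less)
    with min[OF \<open>x \<in> K\<close>] \<open>\<not> thesis\<close> show False
      by blast
  qed
  let ?U = "\<lambda>y. {z\<in>K. f y < f z}"
  have op: "openin (top_of_set K) (?U y)" for y
  proof (subst openin_subopen, intro ballI)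
    fix z assume z: "z \<in> ?U y"
    then have "\<forall>\<^sub>F w in at z within K. f y < f w"
      using lsc unfolding lower_semicontinuous_on_def by blast
    then obtain V where V: "open V" "z \<in> V" "\<And>w. w \<in> V \<Longrightarrow> w \<noteq> z \<Longrightarrow> w \<in> K \<Longrightarrow> f y < f w"
      unfolding eventually_at_topological by blast
    have "openin (top_of_set K) (K \<inter> V)"
      using V(1) by (rule openin_open_Int)
    \<comment> \<open>The filter \<open>at z within K\<close> says nothing about \<open>z\<close>
      itself; that point lies in \<open>?U y\<close> by its choice.\<close>
    moreover have "z \<in> K \<inter> V" "K \<inter> V \<subseteq> ?U y"
      using V z by blast+
    ultimately show "\<exists>T. openin (top_of_set K) T \<and> z \<in> T \<and> T \<subseteq> ?U y"
      by (intro exI conjI)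
  qed
  have "\<forall>U\<in>?U ` K. openin (top_of_set K) U" "K \<subseteq> \<Union>(?U ` K)"
    using op below by blast+
  then have "\<exists>D\<subseteq>?U ` K. finite D \<and> K \<subseteq> \<Union>D"
    using \<open>compact K\<close> unfolding compact_eq_openin_cover by meson
  then obtain D where D: "D \<subseteq> ?U ` K" "finite D" "K \<subseteq> \<Union>D"
    by blast
  obtain F where "F \<subseteq> K" "finite F" "D = ?U ` F"
    using finite_subset_image[OF D(2) D(1)] by blast
  with D have F: "F \<subseteq> K" "finite F" "K \<subseteq> \<Union>(?U ` F)"
    by simp_all
  have "F \<noteq> {}"
    using F(3) \<open>K \<noteq> {}\<close> by blast
  \<comment> \<open>Among the finitely many centres, one with least value is itself covered, hence
    lies strictly above another centre.\<close>
  have "Min (f ` F) \<in> f ` F"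
    using F(2) \<open>F \<noteq> {}\<close> by (intro Min_in) auto
  then obtain y where y: "y \<in> F" "f y = Min (f ` F)"
    by (rule imageE) simp
  then obtain z where z: "z \<in> F" "f z < f y"
    using F(1,3) by blast
  have "f y \<le> f z"
    unfolding y(2) using F(2) z(1) by (intro Min_le) auto
  with z(2) show False
    by simp
qed

section \<open>Lipschitz envelopes\<close>

text \<open>The Pasch-Hausdorff envelope: the infimal convolution of \<open>f\<close> on
  \<open>K\<close> with \<open>k\<close> times the distance. A real \<open>INF\<close> is meaningful
  only over a nonempty set that is bounded below, hence the assumptions of the following
  context.\<close>

definition lipschitz_envelope :: "'a::metric_space set \<Rightarrow> ('a \<Rightarrow> real) \<Rightarrow> real \<Rightarrow> 'a \<Rightarrow> real" where
  "lipschitz_envelope K f k p = (INF q\<in>K. f q + k * dist p q)"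

context
  fixes K :: "'a::metric_space set" and f :: "'a \<Rightarrow> real" and m :: real
  assumes bounded_below: "\<And>q. q \<in> K \<Longrightarrow> m \<le> f q" and nonempty: "K \<noteq> {}"
begin

lemma bdd_below_envelope:
  assumes "0 \<le> k"
  shows "bdd_below ((\<lambda>q. f q + k * dist p q) ` K)"
proof (rule bdd_belowI2)
  fix q assume "q \<in> K"
  then show "m \<le> f q + k * dist p q"
    using bounded_below[of q] mult_nonneg_nonneg[OF assms zero_le_dist[of p q]] by linarith
qed

lemma lipschitz_envelope_le:
  assumes "0 \<le> k" "q \<in> K"
  shows "lipschitz_envelope K f k p \<le> f q + k * dist p q"
  unfolding lipschitz_envelope_def using assms by (intro cINF_lower bdd_below_envelope)

lemma lipschitz_envelope_greatest:
  assumes "\<And>q. q \<in> K \<Longrightarrow> c \<le> f q + k * dist p q"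
  shows "c \<le> lipschitz_envelope K f k p"
  unfolding lipschitz_envelope_def using assms nonempty by (intro cINF_greatest)

lemma lipschitz_envelope_ge:
  assumes "0 \<le> k"
  shows "m \<le> lipschitz_envelope K f k p"
proof (rule lipschitz_envelope_greatest)
  fix q assume "q \<in> K"
  then show "m \<le> f q + k * dist p q"
    using bounded_below[of q] mult_nonneg_nonneg[OF assms zero_le_dist[of p q]] by linarith
qed

lemma lipschitz_envelope_mono:
  assumes "0 \<le> k" "k \<le> l"
  shows "lipschitz_envelope K f k p \<le> lipschitz_envelope K f l p"
proof (rule lipschitz_envelope_greatest)
  fix q assume "q \<in> K"
  then show "lipschitz_envelope K f k p \<le> f q + l * dist p q"
    using lipschitz_envelope_le[of k q p] mult_right_mono[OF assms(2) zero_le_dist[of p q]] assms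
    by linarith
qed

text \<open>By the triangle inequality, moving the base point from \<open>p\<close> to
  \<open>r\<close> changes each penalty term by at most \<open>k * dist p r\<close>, and this passes
  to the infimum.\<close>

lemma lipschitz_on_lipschitz_envelope:
  assumes "0 \<le> k"
  shows "k-lipschitz_on A (lipschitz_envelope K f k)"
proof -
  have "lipschitz_envelope K f k p - k * dist p r \<le> lipschitz_envelope K f k r" for p r
  proof (rule lipschitz_envelope_greatest)
    fix q assume "q \<in> K"
    moreover have "k * dist p q \<le> k * dist p r + k * dist r q"
      using mult_left_mono[OF dist_triangle[of p q r] assms] by (simp add: distrib_left)
    ultimately show "lipschitz_envelope K f k p - k * dist p r \<le> f q + k * dist r q"
      using lipschitz_envelope_le[of k q p] assms by linarith
  qed
  then have "\<bar>lipschitz_envelope K f k p - lipschitz_envelope K f k r\<bar> \<le> k * dist p r" for p r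
    by (smt (verit) dist_commute)
  then show ?thesis
    using assms by (intro lipschitz_onI) (auto simp: dist_real_def)
qed

text \<open>The choice \<open>q = p\<close> bounds the envelope by \<open>f p\<close>. From below,
  points near \<open>p\<close> are controlled by lower semicontinuity, and at all others the growing
  penalty outweighs the bound \<open>m\<close>.\<close>

lemma lipschitz_envelope_tendsto:
  assumes lsc: "lower_semicontinuous_on K f" and p: "p \<in> K"
  shows "(\<lambda>k. lipschitz_envelope K f (real k) p) \<longlonglongrightarrow> f p"
proof (rule order_tendstoI)
  fix c assume "f p < c"
  moreover have "lipschitz_envelope K f (real k) p \<le> f p" for k
    using lipschitz_envelope_le[of "real k" p p] p by simp
  ultimately show "\<forall>\<^sub>F k in sequentially. lipschitz_envelope K f (real k) p < c"
    by (auto intro!: always_eventually intro: le_less_trans)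
next
  fix c assume "c < f p"
  \<comment> \<open>The infimum preserves only non-strict bounds, so a level strictly between
    \<open>c\<close> and \<open>f p\<close> is used.\<close>
  then obtain c' where c': "c < c'" "c' < f p"
    using dense by blast
  then have "\<forall>\<^sub>F q in at p within K. c' < f q"
    using lsc p by (auto simp: lower_semicontinuous_on_def)
  then obtain d where d: "d > 0" "\<And>q. q \<in> K \<Longrightarrow> q \<noteq> p \<Longrightarrow> dist q p < d \<Longrightarrow> c' < f q"
    by (auto simp: eventually_at)
  \<comment> \<open>From \<open>N\<close> on, the penalty at distance at least \<open>d\<close>
    lifts the lower bound \<open>m\<close> above \<open>c'\<close>.\<close>
  obtain N :: nat where N: "(c' - m) / d < real N"
    using reals_Archimedean2 by blast
  have "c < lipschitz_envelope K f (real k) p" if "N \<le> k" for k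
  proof -
    have "c' - m < real k * d"
      using N that \<open>d > 0\<close> by (simp add: divide_less_eq) (smt (verit) mult_right_mono of_nat_mono)
    have "c' \<le> lipschitz_envelope K f (real k) p"
    proof (rule lipschitz_envelope_greatest)
      fix q assume q: "q \<in> K"
      show "c' \<le> f q + real k * dist p q"
      proof (cases "dist p q < d")
        case True
        then have "c' < f q"
          using d(2)[OF q] c' by (cases "q = p") (auto simp: dist_commute)
        then show ?thesis
          by (simp add: add_increasing2 less_imp_le)
      next
        case False
        then have "real k * d \<le> real k * dist p q"
          by (intro mult_left_mono) auto
        with \<open>c' - m < real k * d\<close> bounded_below[OF q] show ?thesis
          by linarith
      qed
    qed
    with c' show ?thesis by simp
  qed
  then show "\<forall>\<^sub>F k in sequentially. c < lipschitz_envelope K f (real k) p"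
    by (auto simp: eventually_sequentially)
qed

end

section \<open>The extended integral and monotone convergence\<close>

lemma extended_integral_mono:
  assumes "\<And>y. y \<in> space M \<Longrightarrow> f y \<le> g y"
  shows "extended_integral M f \<le> extended_integral M g"
  unfolding extended_integral_def
  by (intro ereal_minus_mono) (auto simp flip: less_eq_ennreal.rep_eq
      intro!: nn_integral_mono ennreal_leI assms)

text \<open>Both parts are finite, so \<open>enn2real\<close> loses nothing. This links the expected
  cost of an envelope to the ordinary integral, in terms of which weak convergence is
  stated.\<close>

lemma extended_integral_eq_integral:
  assumes f: "integrable M f"
  shows "extended_integral M f = ereal (LINT y|M. f y)"
proof -
  have fin: "(\<integral>\<^sup>+ y. ennreal (f y) \<partial>M) \<noteq> \<infinity>" "(\<integral>\<^sup>+ y. ennreal (- f y) \<partial>M) \<noteq> \<infinity>"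
    using f by (auto simp: real_integrable_def)
  then have *: "enn2ereal (\<integral>\<^sup>+ y. ennreal (f y) \<partial>M) = ereal (enn2real (\<integral>\<^sup>+ y. ennreal (f y) \<partial>M))"
     "enn2ereal (\<integral>\<^sup>+ y. ennreal (- f y) \<partial>M) = ereal (enn2real (\<integral>\<^sup>+ y. ennreal (- f y) \<partial>M))"
    by (metis enn2ereal_ennreal ennreal_enn2real_if enn2real_nonneg infinity_ennreal_def)+
  show ?thesis
    unfolding extended_integral_def * by (simp add: real_lebesgue_integral_def[OF f])
qed

text \<open>Pointwise, \<open>f + c\<close> plus the negative part of \<open>f\<close> equals the
  positive part of \<open>f\<close> plus \<open>c\<close>; integrate against a measure of total mass
  one. This reduces the signed integral to one of a nonnegative function.\<close>

lemma (in prob_space) extended_integral_shift: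
  assumes [measurable]: "f \<in> borel_measurable M"
    and c: "0 \<le> c" "\<And>y. y \<in> space M \<Longrightarrow> - c \<le> f y"
  shows "extended_integral M f = enn2ereal (\<integral>\<^sup>+ y. ennreal (f y + c) \<partial>M) - ereal c"
proof -
  let ?P = "\<integral>\<^sup>+ y. ennreal (f y) \<partial>M" and ?N = "\<integral>\<^sup>+ y. ennreal (- f y) \<partial>M"
  let ?S = "\<integral>\<^sup>+ y. ennreal (f y + c) \<partial>M"
  have "?S + ?N = (\<integral>\<^sup>+ y. ennreal (f y + c) + ennreal (- f y) \<partial>M)"
    by (simp add: nn_integral_add)
  also have "\<dots> = (\<integral>\<^sup>+ y. ennreal (f y) + ennreal c \<partial>M)"
  proof (rule nn_integral_cong)
    fix y assume "y \<in> space M"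
    then show "ennreal (f y + c) + ennreal (- f y) = ennreal (f y) + ennreal c"
      using c(1) c(2)[of y]
      by (cases "0 \<le> f y") (simp_all add: ennreal_neg flip: ennreal_plus)
  qed
  also have "\<dots> = ?P + ennreal c"
    by (simp add: nn_integral_add emeasure_space_1)
  finally have sum: "enn2ereal ?S + enn2ereal ?N = enn2ereal ?P + ereal c"
    using c by (metis enn2ereal_ennreal plus_ennreal.rep_eq)
  \<comment> \<open>The negative part has finite integral, so \<open>sum\<close> can be rearranged
    in \<open>ereal\<close> without meeting infinity minus infinity.\<close>
  have "?N \<le> (\<integral>\<^sup>+ y. ennreal c \<partial>M)"
    using c by (intro nn_integral_mono ennreal_leI) (simp add: minus_le_iff)
  then have "?N \<le> ennreal c"
    by (simp add: emeasure_space_1)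
  then have "enn2ereal ?N \<le> ereal c"
    using c by (metis enn2ereal_ennreal less_eq_ennreal.rep_eq)
  moreover have "0 \<le> enn2ereal ?N" "0 \<le> enn2ereal ?P" "0 \<le> enn2ereal ?S"
    by auto
  ultimately show ?thesis
    unfolding extended_integral_def using sum
    by (cases "enn2ereal ?N"; cases "enn2ereal ?P"; cases "enn2ereal ?S") auto
qed

text \<open>After the shift by \<open>c\<close> this is monotone convergence for nonnegative
  functions; subtracting the finite \<open>c\<close> again is continuous on
  \<open>ereal\<close>.\<close>

lemma (in prob_space) extended_integral_monotone_convergence:
  fixes f :: "nat \<Rightarrow> 'a \<Rightarrow> real"
  assumes meas: "\<And>k. f k \<in> borel_measurable M"
    and inc: "\<And>y. y \<in> space M \<Longrightarrow> incseq (\<lambda>k. f k y)"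
    and lim: "\<And>y. y \<in> space M \<Longrightarrow> (\<lambda>k. f k y) \<longlonglongrightarrow> g y"
    and lb: "\<And>k y. y \<in> space M \<Longrightarrow> - c \<le> f k y" and "0 \<le> c"
  shows "(\<lambda>k. extended_integral M (f k)) \<longlonglongrightarrow> extended_integral M g"
proof -
  note [measurable] = meas
  \<comment> \<open>Measurability passes to the pointwise limit; in this way the sections of
    \<theta> inherit it from those of the envelopes.\<close>
  have [measurable]: "g \<in> borel_measurable M"
    using lim meas by (rule borel_measurable_LIMSEQ_real)
  have glb: "- c \<le> g y" if "y \<in> space M" for y
    using lim[OF that] lb[OF that] by (intro LIMSEQ_le_const) auto
  let ?h = "\<lambda>k y. ennreal (f k y + c)"
  have sup: "(SUP k. ?h k y) = ennreal (g y + c)" if "y \<in> space M" for y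
  proof (rule LIMSEQ_unique)
    show "(\<lambda>k. ?h k y) \<longlonglongrightarrow> (SUP k. ?h k y)"
      using inc[OF that] by (intro LIMSEQ_SUP) (auto simp: incseq_def intro!: ennreal_leI)
    show "(\<lambda>k. ?h k y) \<longlonglongrightarrow> ennreal (g y + c)"
      using lim[OF that] by (intro tendsto_intros)
  qed
  have "(\<integral>\<^sup>+ y. ennreal (g y + c) \<partial>M) = (\<integral>\<^sup>+ y. (SUP k. ?h k y) \<partial>M)"
    using sup by (intro nn_integral_cong) simp
  also have "\<dots> = (SUP k. \<integral>\<^sup>+ y. ?h k y \<partial>M)"
    using inc by (intro nn_integral_monotone_convergence_SUP_AE)
      (auto simp: incseq_Suc_iff intro!: AE_I2 ennreal_leI)
  finally have eq: "(\<integral>\<^sup>+ y. ennreal (g y + c) \<partial>M) = (SUP k. \<integral>\<^sup>+ y. ?h k y \<partial>M)" .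
  have "(\<lambda>k. \<integral>\<^sup>+ y. ?h k y \<partial>M) \<longlonglongrightarrow> (\<integral>\<^sup>+ y. ennreal (g y + c) \<partial>M)"
    unfolding eq using inc
    by (intro LIMSEQ_SUP) (auto simp: incseq_def intro!: nn_integral_mono ennreal_leI)
  then have "(\<lambda>k. enn2ereal (\<integral>\<^sup>+ y. ?h k y \<partial>M)) \<longlonglongrightarrow> enn2ereal (\<integral>\<^sup>+ y. ennreal (g y + c) \<partial>M)"
    by (rule tendsto_enn2erealI)
  then have "(\<lambda>k. enn2ereal (\<integral>\<^sup>+ y. ?h k y \<partial>M) - ereal c)
      \<longlonglongrightarrow> enn2ereal (\<integral>\<^sup>+ y. ennreal (g y + c) \<partial>M) - ereal c"
    by (intro tendsto_diff_ereal_general tendsto_const) auto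
  then show ?thesis
    using \<open>0 \<le> c\<close> lb glb by (simp add: extended_integral_shift)
qed

section \<open>Integrals against a weakly continuous family of measures\<close>

lemma borel_probabilities_space:
  assumes "M \<in> borel_probabilities Y"
  shows "space M = Y" "prob_space M"
  using assms sets_eq_imp_space_eq[of M "restrict_space borel Y"]
  by (auto simp: borel_probabilities_def space_restrict_space)

lemma borel_probabilities_measurable:
  fixes f :: "'a::topological_space \<Rightarrow> real"
  assumes "M \<in> borel_probabilities Y" "continuous_on Y f"
  shows "f \<in> borel_measurable M"
proof -
  have "sets M = sets (restrict_space borel Y)"
    using assms by (simp add: borel_probabilities_def)
  then show ?thesis
    using borel_measurable_continuous_on_restrict[OF assms(2)] measurable_cong_sets by blast
qed

lemma borel_probabilities_integrable:
  fixes f :: "'a::topological_space \<Rightarrow> real"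
  assumes M: "M \<in> borel_probabilities Y" and "compact Y" and f: "continuous_on Y f"
  shows "integrable M f"
proof -
  interpret prob_space M
    using borel_probabilities_space[OF M] by simp
  have "bounded (f ` Y)"
    using compact_continuous_image[OF f \<open>compact Y\<close>] compact_imp_bounded by blast
  then obtain B where "\<And>y. y \<in> Y \<Longrightarrow> norm (f y) \<le> B"
    by (auto simp: bounded_iff)
  then show ?thesis
    using borel_probabilities_space[OF M] borel_probabilities_measurable[OF M f]
    by (intro integrable_const_bound[of _ B]) (auto intro!: AE_I2)
qed

text \<open>Along a sequence, the integrand and the measure both vary. Replacing
  \<open>h (xs n, y)\<close> by \<open>h (x, y)\<close> costs little under every probability
  measure, by uniform continuity of \<open>h\<close>; what remains is a fixed integrand, to which
  weak convergence applies.\<close>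

lemma continuous_on_integral_weak_continuous:
  fixes h :: "'x::metric_space \<times> 'y::metric_space \<Rightarrow> real"
  assumes "compact X" "compact Y" and h: "continuous_on (X \<times> Y) h"
    and \<beta>: "\<And>x. x \<in> X \<Longrightarrow> \<beta> x \<in> borel_probabilities Y"
    and weak: "weak_continuous_on X Y \<beta>"
  shows "continuous_on X (\<lambda>x. LINT y|\<beta> x. h (x, y))"
proof -
  have cont: "continuous_on Y (\<lambda>y. h (x, y))" if "x \<in> X" for x
    using that by (intro continuous_on_compose2[OF h]) (auto intro!: continuous_intros)
  have int: "integrable (\<beta> z) (\<lambda>y. h (x, y))" if "z \<in> X" "x \<in> X" for x z
    using borel_probabilities_integrable \<beta> \<open>compact Y\<close> cont that by blast
  have unif: "uniformly_continuous_on (X \<times> Y) h"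
    using assms by (intro compact_uniformly_continuous compact_Times)
  show ?thesis
    unfolding continuous_on_sequentially
  proof (intro allI ballI impI, elim conjE)
    fix xs x assume x: "x \<in> X" and xs: "\<forall>n. xs n \<in> X" "xs \<longlonglongrightarrow> x"
    \<comment> \<open>On a compact \<open>Y\<close> every continuous function is an admissible test
      function.\<close>
    have "bounded {y \<in> Y. h (x, y) \<noteq> 0}"
      using compact_imp_bounded[OF \<open>compact Y\<close>] by (rule bounded_subset) auto
    then have lim: "(\<lambda>n. LINT y|\<beta> (xs n). h (x, y)) \<longlonglongrightarrow> (LINT y|\<beta> x. h (x, y))"
      using weak x xs cont[OF x] by (auto simp: weak_continuous_on_def weakly_convergent_to_def)
    have "(\<lambda>n. (LINT y|\<beta> (xs n). h (xs n, y)) - (LINT y|\<beta> (xs n). h (x, y))) \<longlonglongrightarrow> 0"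
    proof (rule LIMSEQ_I)
      fix e :: real assume "e > 0"
      \<comment> \<open>Half of \<open>e\<close> leaves room, since integrating the pointwise bound
        gives only a non-strict inequality.\<close>
      then obtain d where d: "d > 0" "\<And>p q. p \<in> X \<times> Y \<Longrightarrow> q \<in> X \<times> Y \<Longrightarrow> dist q p < d
          \<Longrightarrow> dist (h q) (h p) < e / 2"
        using unif unfolding uniformly_continuous_on_def by (metis half_gt_zero)
      obtain N where N: "\<And>n. n \<ge> N \<Longrightarrow> dist (xs n) x < d"
        using metric_LIMSEQ_D[OF xs(2) d(1)] by blast
      have "norm ((LINT y|\<beta> (xs n). h (xs n, y)) - (LINT y|\<beta> (xs n). h (x, y)) - 0) < e"
        if n: "n \<ge> N" for n
      proof -
        note b = \<beta>[OF xs(1)[rule_format, of n]]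
        interpret prob_space "\<beta> (xs n)"
          using borel_probabilities_space[OF b] by simp
        have close: "\<bar>h (xs n, y) - h (x, y)\<bar> \<le> e / 2" if "y \<in> Y" for y
          using d(2)[of "(x, y)" "(xs n, y)"] N[OF n] x xs that
          by (simp add: dist_Pair_Pair dist_real_def)
        have i: "integrable (\<beta> (xs n)) (\<lambda>y. h (xs n, y) - h (x, y))"
          using int x xs by (intro Bochner_Integration.integrable_diff) auto
        have "\<bar>LINT y|\<beta> (xs n). h (xs n, y) - h (x, y)\<bar>
            \<le> (LINT y|\<beta> (xs n). \<bar>h (xs n, y) - h (x, y)\<bar>)"
          by (rule integral_abs_bound)
        also have "\<dots> \<le> (LINT y|\<beta> (xs n). e / 2)"
          using i close borel_probabilities_space[OF b]
          by (intro integral_mono integrable_abs) auto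
        also have "\<dots> < e"
          using \<open>e > 0\<close> prob_space by simp
        finally show ?thesis
          using int x xs by (simp add: Bochner_Integration.integral_diff)
      qed
      then show "\<exists>N. \<forall>n\<ge>N. norm ((LINT y|\<beta> (xs n). h (xs n, y))
          - (LINT y|\<beta> (xs n). h (x, y)) - 0) < e"
        by blast
    qed
    from tendsto_add[OF this lim]
    show "((\<lambda>x. LINT y|\<beta> x. h (x, y)) \<circ> xs) \<longlonglongrightarrow> (LINT y|\<beta> x. h (x, y))"
      by (simp add: o_def)
  qed
qed

section \<open>Lower semicontinuity of the expected cost and existence of a solution\<close>

lemma lower_semicontinuous_on_expected_cost:
  fixes \<theta> :: "'x::metric_space \<times> 'y::metric_space \<Rightarrow> real"
  assumes "compact X" "compact Y" "X \<noteq> {}" "Y \<noteq> {}"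
    and lsc: "lower_semicontinuous_on (X \<times> Y) \<theta>"
    and \<beta>: "\<And>x. x \<in> X \<Longrightarrow> \<beta> x \<in> borel_probabilities Y"
    and weak: "weak_continuous_on X Y \<beta>"
  shows "lower_semicontinuous_on X (expected_cost \<beta> \<theta>)"
proof -
  let ?K = "X \<times> Y"
  have K: "compact ?K" "?K \<noteq> {}"
    using assms by (auto intro: compact_Times)
  \<comment> \<open>The minimum of \<theta> over the compact product is the lower bound that the
    envelopes require.\<close>
  obtain p\<^sub>0 where p\<^sub>0: "\<And>q. q \<in> ?K \<Longrightarrow> \<theta> p\<^sub>0 \<le> \<theta> q"
    using lower_semicontinuous_on_attains_min[OF lsc K] by blast
  define h where "h k = lipschitz_envelope ?K \<theta> (real k)" for k
  \<comment> \<open>The absolute value makes \<open>c\<close> nonnegative while \<open>- c\<close>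
    stays below the minimum, as the convergence lemma demands.\<close>
  define c where "c = \<bar>\<theta> p\<^sub>0\<bar>"
  note env = p\<^sub>0 K(2)
  have h_cont: "continuous_on A (h k)" for A k
    unfolding h_def using lipschitz_on_lipschitz_envelope[OF env of_nat_0_le_iff]
    by (rule lipschitz_on_continuous_on)
  have h_sec: "continuous_on Y (\<lambda>y. h k (x, y))" for k x
    by (intro continuous_on_compose2[OF h_cont[of UNIV]]) (auto intro!: continuous_intros)
  have h_le: "h k p \<le> \<theta> p" if "p \<in> ?K" for k p
    using lipschitz_envelope_le[where f = \<theta>, OF env of_nat_0_le_iff that, of k p] by (simp add: h_def)
  have h_ge: "- c \<le> h k p" for k p
    using lipschitz_envelope_ge[where f = \<theta>, OF env of_nat_0_le_iff, of k p] by (simp add: h_def c_def)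
  have h_inc: "incseq (\<lambda>k. h k p)" for p
    unfolding h_def by (intro incseq_SucI lipschitz_envelope_mono[OF env]) auto
  have h_lim: "(\<lambda>k. h k p) \<longlonglongrightarrow> \<theta> p" if "p \<in> ?K" for p
    unfolding h_def using lipschitz_envelope_tendsto[OF env lsc that] .
  have cost_h: "expected_cost \<beta> (h k) x = ereal (LINT y|\<beta> x. h k (x, y))" if "x \<in> X" for k x
    unfolding expected_cost_def
    using borel_probabilities_integrable[OF \<beta>[OF that] \<open>compact Y\<close> h_sec]
    by (rule extended_integral_eq_integral)
  show ?thesis
    unfolding lower_semicontinuous_on_def
  proof (intro ballI allI impI)
    fix x a assume x: "x \<in> X" and a: "a < expected_cost \<beta> \<theta> x"
    interpret prob_space "\<beta> x"
      using borel_probabilities_space[OF \<beta>[OF x]] by simp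
    have "(\<lambda>k. expected_cost \<beta> (h k) x) \<longlonglongrightarrow> expected_cost \<beta> \<theta> x"
      unfolding expected_cost_def
      using h_lim h_inc h_ge x borel_probabilities_space[OF \<beta>[OF x]]
        borel_probabilities_measurable[OF \<beta>[OF x] h_sec]
      by (intro extended_integral_monotone_convergence[where c = c]) (auto simp: c_def)
    \<comment> \<open>A single envelope already exceeds \<open>a\<close> at \<open>x\<close>; its
      continuous integral stays above \<open>a\<close> nearby, and the cost of \<theta> dominates it
      there.\<close>
    then have "\<forall>\<^sub>F k in sequentially. a < expected_cost \<beta> (h k) x"
      using a by (rule order_tendstoD)
    then obtain k where k: "a < ereal (LINT y|\<beta> x. h k (x, y))"
      using cost_h[OF x] by (auto simp: eventually_sequentially)
    have "continuous_on X (\<lambda>x. LINT y|\<beta> x. h k (x, y))"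
      using assms h_cont by (intro continuous_on_integral_weak_continuous)
    then have "((\<lambda>z. ereal (LINT y|\<beta> z. h k (z, y))) \<longlongrightarrow> ereal (LINT y|\<beta> x. h k (x, y)))
        (at x within X)"
      using x by (auto simp: continuous_on_def)
    then have "\<forall>\<^sub>F z in at x within X. a < ereal (LINT y|\<beta> z. h k (z, y))"
      using k by (rule order_tendstoD)
    moreover have "\<forall>\<^sub>F z in at x within X. z \<in> X"
      by (simp add: eventually_at_filter)
    ultimately show "\<forall>\<^sub>F z in at x within X. a < expected_cost \<beta> \<theta> z"
    proof eventually_elim
      case (elim z)
      have "expected_cost \<beta> (h k) z \<le> expected_cost \<beta> \<theta> z"
        unfolding expected_cost_def using elim borel_probabilities_space[OF \<beta>[OF elim(2)]] h_le
        by (intro extended_integral_mono) auto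
      with elim show ?case
        using cost_h by (metis less_le_trans)
    qed
  qed
qed

theorem theorem2:
  fixes X :: "(real ^ 'd) set"
    and Y :: "(real ^ 'p) set"
    and S :: "real ^ 'd \<Rightarrow> (real ^ 'p) set"
    and \<beta> :: "real ^ 'd \<Rightarrow> (real ^ 'p) measure"
    and \<theta> :: "(real ^ 'd) \<times> (real ^ 'p) \<Rightarrow> real"
  assumes "Y \<noteq> {}" and "compact Y"
    and "\<And>x. x \<in> X \<Longrightarrow> S x \<subseteq> Y \<and> S x \<noteq> {}"
    and "closedin (top_of_set (X \<times> Y)) {(x, y). x \<in> X \<and> y \<in> S x}"
    and "belief_over X Y S \<beta>"
    and "lower_semicontinuous_on (X \<times> Y) \<theta>"
    and "X \<noteq> {}" and "compact X"
    and "weak_continuous_on X Y \<beta>"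
  shows "lower_semicontinuous_on X (expected_cost \<beta> \<theta>) \<and>
         (\<exists>x. is_arg_min (expected_cost \<beta> \<theta>) (\<lambda>x. x \<in> X) x)"
proof -
  have \<beta>: "\<And>x. x \<in> X \<Longrightarrow> \<beta> x \<in> borel_probabilities Y"
    using assms by (auto simp: belief_over_def)
  have lsc: "lower_semicontinuous_on X (expected_cost \<beta> \<theta>)"
    using assms \<beta> by (intro lower_semicontinuous_on_expected_cost)
  \<comment> \<open>The minimum is taken in \<open>ereal\<close>, so it exists even if the expected
    cost is infinite everywhere.\<close>
  obtain x where "x \<in> X" "\<And>y. y \<in> X \<Longrightarrow> expected_cost \<beta> \<theta> x \<le> expected_cost \<beta> \<theta> y"
    using lower_semicontinuous_on_attains_min[OF lsc] assms by blast
  then have "is_arg_min (expected_cost \<beta> \<theta>) (\<lambda>x. x \<in> X) x"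
    by (auto simp: is_arg_min_linorder)
  with lsc show ?thesis
    by blast
qed

end
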